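(* Let $n\ge1$, let $\varphi(x;s)=\sum_{\mu\in Q_+}x^{-\mu}\varphi_\mu(s)\in\mathbb{C}(s^{-Q_+})[[x^{-Q_+}]]$ be the unique series with $\varphi_0(s)=1$ such that $f(x;s)=x^\lambda\varphi(x;s)$, with $s_i=t^{n-i}q^{\lambda_i}$, satisfies $D^{x}(u)f(x;s)=f(x;s)\prod_{i=1}^n(1-us_i)$, and define $\psi(x;s)$ by $$\varphi(x;s)=\prod_{1\le i<j\le n}\frac{(qx_j/x_i;q)_\infty}{(qx_j/tx_i;q)_\infty}\ \psi(x;s).$$ Then the series $\psi(x;s)\in\mathbb{C}(s^{-Q_+})[[x^{-Q_+}]]$ is invariant under the change of parameters $t\leftrightarrow q/t$ (with $q$, $x$ and $s$ kept fixed).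
   Context: Fix $q,t\in\mathbb{C}^*$ with $|q|<1$; $(z;q)_\infty=\prod_{k\ge0}(1-q^kz)$. $T_{q,x_i}$ is the $q$-shift operator $x_i\mapsto qx_i$. The Ruijsenaars-Macdonald operators in $x=(x_1,\ldots,x_n)$ with parameter $t$ are $$D_r^{x}=t^{\binom{r}{2}}\sum_{|I|=r}\ \prod_{i\in I,\,j\notin I}\frac{tx_i-x_j}{x_i-x_j}\prod_{i\in I}T_{q,x_i}\quad(0\le r\le n),\qquad D^x(u)=\sum_{r=0}^n(-u)^rD^x_r ,$$ summed over $I\subseteq\{1,\ldots,n\}$. $Q_+=\bigoplus_{i=1}^{n-1}\mathbb{N}(\epsilon_i-\epsilon_{i+1})$, $x^{-\mu}=\prod_ix_i^{-\mu_i}$ for $\mu=\sum_i\mu_i\epsilon_i$, $\mathbb{C}[[x^{-Q_+}]]=\mathbb{C}[[x_2/x_1,\ldots,x_n/x_{n-1}]]$, $\mathbb{C}(s^{-Q_+})=\mathbb{C}(s_2/s_1,\ldots,s_n/s_{n-1})$; for $i<j$, $x_j/x_i$ denotes $\prod_{a=i}^{j-1}x_{a+1}/x_a$. Formal conventions: $x^\lambda$ is a symbol with $T_{q,x_i}x^\lambda=s_it^{i-n}x^\lambda$; coefficients of $D^x_r$ are expanded as power series in $x_j/x_i$ $(i<j)$; $T_{q,x_i}x^{-\mu}=q^{-\mu_i}x^{-\mu}$; $s_1,\ldots,s_n$ are indeterminates. Equivalently, $\psi$ is the unique series with leading coefficient $\psi_0(s)=1$ solving $$\sum_{I\subseteq\{1,\ldots,n\}}(-u)^{|I|}\prod_{i\in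 I}s_i\prod_{i<j;\,i\notin I,\,j\in I}\frac{(1-tx_j/x_i)(1-qx_j/tx_i)}{(1-x_j/x_i)(1-qx_j/x_i)}\prod_{i\in I}T_{q,x_i}\,\psi(x;s)=\psi(x;s)\prod_{i=1}^n(1-us_i).$$ *)

theory Defs
  imports
    "HOL-Library.Poly_Mapping"
    "HOL-Computational_Algebra.Fraction_Field"
    "HOL-Complex_Analysis.Complex_Analysis"
begin

section \<open>Formal power series in several variables\<close>

text \<open>
  Formal power series in countably many variables \<open>z\<^sub>0, z\<^sub>1, \<dots>\<close>: arbitrary coefficient functions
  on the monomials, which are finitely supported exponent vectors \<open>m\<close>, with the Cauchy product.
\<close>

typedef 'k mfps = "UNIV :: ((nat \<Rightarrow>\<^sub>0 nat) \<Rightarrow> 'k) set"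
  morphisms mcoeff Mfps
  by simp

setup_lifting type_definition_mfps

lemma mfps_eqI: "(\<And>m. mcoeff F m = mcoeff G m) \<Longrightarrow> F = G"
  by (metis mcoeff_inject ext)

lemma mcoeff_Mfps [simp]: "mcoeff (Mfps f) = f"
  by (simp add: Mfps_inverse)

definition splits :: "(nat \<Rightarrow>\<^sub>0 nat) \<Rightarrow> ((nat \<Rightarrow>\<^sub>0 nat) \<times> (nat \<Rightarrow>\<^sub>0 nat)) set" where
  "splits m = {(a, b). a + b = m}"

lemma finite_splits [simp]: "finite (splits m)"
proof -
  let ?K = "Poly_Mapping.keys m"
  let ?F = "{f. \<forall>x. (x \<in> ?K \<longrightarrow> f x \<in> {..Max (insert 0 (Poly_Mapping.lookup m ` ?K))})
                 \<and> (x \<notin> ?K \<longrightarrow> f x = (0::nat))}"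
  have fin: "finite ?F"
    by (rule finite_set_of_finite_funs) auto
  have bound: "Poly_Mapping.lookup a \<in> ?F"
    if le: "\<And>x. Poly_Mapping.lookup a x \<le> Poly_Mapping.lookup m x" for a
  proof -
    have "Poly_Mapping.lookup a x \<le> Max (insert 0 (Poly_Mapping.lookup m ` ?K))" if "x \<in> ?K" for x
    proof -
      have "Poly_Mapping.lookup m x \<le> Max (insert 0 (Poly_Mapping.lookup m ` ?K))"
        using that by (intro Max_ge) auto
      with le[of x] show ?thesis by linarith
    qed
    moreover have "Poly_Mapping.lookup a x = 0" if "x \<notin> ?K" for x
      using le[of x] that by (simp add: in_keys_iff)
    ultimately show ?thesis by simp
  qed
  have "(\<lambda>(a, b). (Poly_Mapping.lookup a, Poly_Mapping.lookup b)) ` splits m \<subseteq> ?F \<times> ?F"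
  proof
    fix p assume "p \<in> (\<lambda>(a, b). (Poly_Mapping.lookup a, Poly_Mapping.lookup b)) ` splits m"
    then obtain a b where p: "p = (Poly_Mapping.lookup a, Poly_Mapping.lookup b)" and m: "m = a + b"
      by (auto simp: splits_def)
    have "Poly_Mapping.lookup a \<in> ?F" "Poly_Mapping.lookup b \<in> ?F"
      by (rule bound, simp add: m lookup_add)+
    then show "p \<in> ?F \<times> ?F"
      unfolding p by (rule SigmaI)
  qed
  moreover have "inj_on (\<lambda>(a, b). (Poly_Mapping.lookup a, Poly_Mapping.lookup b)) (splits m)"
    by (auto simp: inj_on_def poly_mapping_eqI)
  ultimately show ?thesis
    using fin by (meson finite_SigmaI finite_imageD finite_subset)
qed

instantiation mfps :: (zero) zero
begin
lift_definition zero_mfps :: "'a mfps" is "\<lambda>_. 0" .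
instance ..
end

instantiation mfps :: ("{zero, one}") one
begin
lift_definition one_mfps :: "'a mfps" is "\<lambda>m. if m = 0 then 1 else 0" .
instance ..
end

instantiation mfps :: (plus) plus
begin
lift_definition plus_mfps :: "'a mfps \<Rightarrow> 'a mfps \<Rightarrow> 'a mfps" is "\<lambda>f g m. f m + g m" .
instance ..
end

instantiation mfps :: (minus) minus
begin
lift_definition minus_mfps :: "'a mfps \<Rightarrow> 'a mfps \<Rightarrow> 'a mfps" is "\<lambda>f g m. f m - g m" .
instance ..
end

instantiation mfps :: (uminus) uminus
begin
lift_definition uminus_mfps :: "'a mfps \<Rightarrow> 'a mfps" is "\<lambda>f m. - f m" .
instance ..
end

instantiation mfps :: ("{comm_monoid_add, times}") times
begin
lift_definition times_mfps :: "'a mfps \<Rightarrow> 'a mfps \<Rightarrow> 'a mfps"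
  is "\<lambda>f g m. \<Sum>(a, b)\<in>splits m. f a * g b" .
instance ..
end

lemma mcoeff_zero [simp]: "mcoeff 0 m = 0"
  by transfer simp
lemma mcoeff_one: "mcoeff 1 m = (if m = 0 then 1 else 0)"
  by transfer simp
lemma mcoeff_add [simp]: "mcoeff (F + G) m = mcoeff F m + mcoeff G m"
  by transfer simp
lemma mcoeff_diff [simp]: "mcoeff (F - G) m = mcoeff F m - mcoeff G m"
  by transfer simp
lemma mcoeff_uminus [simp]: "mcoeff (- F) m = - mcoeff F m"
  by transfer simp
lemma mcoeff_mult: "mcoeff (F * G) m = (\<Sum>(a, b)\<in>splits m. mcoeff F a * mcoeff G b)"
  by transfer simp

instance mfps :: (comm_ring_1) comm_ring_1
proof
  fix F G H :: "'a mfps"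
  show "F + G + H = F + (G + H)"
    by (rule mfps_eqI) (simp add: add.assoc)
  show "F + G = G + F"
    by (rule mfps_eqI) (simp add: add.commute)
  show "0 + F = F"
    by (rule mfps_eqI) simp
  show "- F + F = 0"
    by (rule mfps_eqI) simp
  show "F - G = F + - G"
    by (rule mfps_eqI) simp
  show "(0::'a mfps) \<noteq> 1"
    by (metis mcoeff_one mcoeff_zero zero_neq_one)
  show "(F + G) * H = F * H + G * H"
    by (rule mfps_eqI) (simp add: mcoeff_mult algebra_simps sum.distrib case_prod_unfold)
  show comm: "F * G = G * F" for F G :: "'a mfps"
    by (rule mfps_eqI, unfold mcoeff_mult)
      (rule sum.reindex_bij_witness[where i = prod.swap and j = prod.swap],
        auto simp: splits_def add.commute mult.commute)
  show "1 * F = F"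
  proof (rule mfps_eqI)
    fix m
    have "mcoeff (1 * F) m = (\<Sum>(a, b)\<in>{(0, m)}. mcoeff 1 a * mcoeff F b)"
      unfolding mcoeff_mult
      by (rule sum.mono_neutral_right)
        (simp_all, auto simp: splits_def mcoeff_one split: if_splits)
    then show "mcoeff (1 * F) m = mcoeff F m"
      by (simp add: mcoeff_one)
  qed
  show "F * G * H = F * (G * H)"
  proof (rule mfps_eqI)
    fix m
    have "mcoeff (F * G * H) m =
        (\<Sum>x\<in>Sigma (splits m) (\<lambda>x. splits (fst x)).
          mcoeff F (fst (snd x)) * mcoeff G (snd (snd x)) * mcoeff H (snd (fst x)))"
      by (simp add: mcoeff_mult case_prod_unfold sum_distrib_right sum.Sigma)
    also have "\<dots> = (\<Sum>x\<in>Sigma (splits m) (\<lambda>x. splits (snd x)).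
          mcoeff F (fst (fst x)) * (mcoeff G (fst (snd x)) * mcoeff H (snd (snd x))))"
      by (rule sum.reindex_bij_witness
            [where i = "\<lambda>((a, b), (c, d)). ((a + c, d), (a, c))"
               and j = "\<lambda>((a, b), (c, d)). ((c, d + b), (d, b))"])
        (auto simp: splits_def ac_simps)
    also have "\<dots> = mcoeff (F * (G * H)) m"
      by (simp add: mcoeff_mult case_prod_unfold sum_distrib_left sum.Sigma)
    finally show "mcoeff (F * G * H) m = mcoeff (F * (G * H)) m" .
  qed
qed

definition mconst :: "'k \<Rightarrow> 'k::zero mfps" where
  "mconst c = Mfps (\<lambda>m. if m = 0 then c else 0)"

definition map_mfps :: "('k \<Rightarrow> 'l) \<Rightarrow> 'k mfps \<Rightarrow> 'l mfps" where
  "map_mfps h F = Mfps (\<lambda>m. h (mcoeff F m))"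


section \<open>Rational functions in the spectral variables\<close>

text \<open>The field \<open>\<complex>(s\<^sub>0, s\<^sub>1, \<dots>)\<close>.  Only \<open>s\<^sub>1, \<dots>, s\<^sub>n\<close> are used below.\<close>

type_synonym ratfun = "((nat \<Rightarrow>\<^sub>0 nat) \<Rightarrow>\<^sub>0 complex) fract"

definition cst :: "complex \<Rightarrow> ratfun" where
  "cst c = Fraction_Field.Fract (Poly_Mapping.single 0 c) 1"

definition svar :: "nat \<Rightarrow> ratfun" where
  "svar i = Fraction_Field.Fract (Poly_Mapping.single (Poly_Mapping.single i 1) 1) 1"

text \<open>The subfield \<open>\<complex>(s\<^sub>2/s\<^sub>1, \<dots>, s\<^sub>n/s\<^sub>n\<^sub>-\<^sub>1)\<close> of \<open>\<complex>(s\<^sub>1, \<dots>, s\<^sub>n)\<close>.\<close>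

inductive_set ratio_field :: "nat \<Rightarrow> ratfun set" for n where
  cst: "cst c \<in> ratio_field n"
| ratio: "1 \<le> a \<Longrightarrow> a < n \<Longrightarrow> svar (Suc a) / svar a \<in> ratio_field n"
| add: "x \<in> ratio_field n \<Longrightarrow> y \<in> ratio_field n \<Longrightarrow> x + y \<in> ratio_field n"
| uminus: "x \<in> ratio_field n \<Longrightarrow> - x \<in> ratio_field n"
| mult: "x \<in> ratio_field n \<Longrightarrow> y \<in> ratio_field n \<Longrightarrow> x * y \<in> ratio_field n"
| inverse: "x \<in> ratio_field n \<Longrightarrow> inverse x \<in> ratio_field n"


section \<open>Series in the ratios of the $x$-variables\<close>

text \<open>
  The series variable \<open>z\<^sub>a\<close> stands for \<open>x\<^sub>a\<^sub>+\<^sub>1/x\<^sub>a\<close>, \<open>1 \<le> a < n\<close>.  The monomial with exponents \<open>m\<close> is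
  \<open>x\<^sup>-\<^sup>\<mu>\<close> for \<open>\<mu> = \<Sum>\<^sub>a m\<^sub>a (\<epsilon>\<^sub>a - \<epsilon>\<^sub>a\<^sub>+\<^sub>1) \<in> Q\<^sub>+\<close>, and \<open>Qplus n\<close> is the set of these exponents.
  The \<open>i\<close>-th coordinate \<open>\<mu>\<^sub>i = m\<^sub>i - m\<^sub>i\<^sub>-\<^sub>1\<close> is \<open>wt m i\<close>; here \<open>m\<^sub>0 = m\<^sub>n = 0\<close> for \<open>m\<close> in \<open>Qplus n\<close>.
\<close>

definition Qplus :: "nat \<Rightarrow> (nat \<Rightarrow>\<^sub>0 nat) set" where
  "Qplus n = {m. Poly_Mapping.keys m \<subseteq> {1..<n}}"

definition wt :: "(nat \<Rightarrow>\<^sub>0 nat) \<Rightarrow> nat \<Rightarrow> int" where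
  "wt m i = int (Poly_Mapping.lookup m i) - int (Poly_Mapping.lookup m (i - 1))"

text \<open>\<open>\<complex>(s\<^sup>-\<^sup>Q\<^sup>+)[[x\<^sup>-\<^sup>Q\<^sup>+]]\<close>\<close>

definition xseries :: "nat \<Rightarrow> ratfun mfps set" where
  "xseries n = {F. (\<forall>m \<in> Qplus n. mcoeff F m \<in> ratio_field n) \<and> (\<forall>m. m \<notin> Qplus n \<longrightarrow> mcoeff F m = 0)}"

text \<open>
  For \<open>1 \<le> i < j\<close>, \<open>at_ratio i j F\<close> is the substitution \<open>F(x\<^sub>j/x\<^sub>i)\<close> of the monomial
  \<open>x\<^sub>j/x\<^sub>i = z\<^sub>i z\<^sub>i\<^sub>+\<^sub>1 \<cdots> z\<^sub>j\<^sub>-\<^sub>1\<close> into a power series \<open>F\<close> in one variable: the coefficient at \<open>m\<close> is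
  \<open>F\<^sub>k\<close> if \<open>m\<close> equals \<open>k\<close> on \<open>{i..<j}\<close> and \<open>0\<close> elsewhere.
\<close>

definition at_ratio :: "nat \<Rightarrow> nat \<Rightarrow> complex fps \<Rightarrow> ratfun mfps" where
  "at_ratio i j F = Mfps (\<lambda>m. let k = Poly_Mapping.lookup m i in
     if \<forall>a. Poly_Mapping.lookup m a = (if i \<le> a \<and> a < j then k else 0)
     then cst (fps_nth F k) else 0)"


section \<open>Ruijsenaars-Macdonald operators on \<open>x\<^sup>\<lambda>\<close> times a series\<close>

text \<open>
  The expansion of \<open>(t x\<^sub>i - x\<^sub>j)/(x\<^sub>i - x\<^sub>j)\<close> in powers of \<open>X = x\<^sub>j/x\<^sub>i\<close> if \<open>i < j\<close>, and in powers of
  \<open>X = x\<^sub>i/x\<^sub>j\<close> if \<open>j < i\<close>.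
\<close>

definition RM_factor :: "complex \<Rightarrow> nat \<Rightarrow> nat \<Rightarrow> ratfun mfps" where
  "RM_factor t i j =
     (if i < j then at_ratio i j ((fps_const t - fps_X) / (1 - fps_X))
      else at_ratio j i ((fps_const t * fps_X - 1) / (fps_X - 1)))"

text \<open>
  Operators act on \<open>f = x\<^sup>\<lambda> F\<close> and are recorded through their effect on \<open>F\<close>.  By
  \<open>T\<^sub>q\<^sub>,\<^sub>x\<^sub>i x\<^sup>\<lambda> = s\<^sub>i t\<^sup>i\<^sup>-\<^sup>n x\<^sup>\<lambda>\<close> and \<open>T\<^sub>q\<^sub>,\<^sub>x\<^sub>i x\<^sup>-\<^sup>\<mu> = q\<^sup>-\<^sup>\<mu>\<^sup>i x\<^sup>-\<^sup>\<mu>\<close>, the product of the commuting operators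
  \<open>T\<^sub>q\<^sub>,\<^sub>x\<^sub>i\<close>, \<open>i \<in> I\<close>, multiplies the coefficient of \<open>x\<^sup>\<lambda>\<^sup>-\<^sup>\<mu>\<close> by \<open>\<Prod>\<^sub>i\<^sub>\<in>\<^sub>I s\<^sub>i t\<^sup>i\<^sup>-\<^sup>n q\<^sup>-\<^sup>\<mu>\<^sup>i\<close>.
\<close>

definition q_shift :: "nat \<Rightarrow> complex \<Rightarrow> complex \<Rightarrow> nat set \<Rightarrow> ratfun mfps \<Rightarrow> ratfun mfps" where
  "q_shift n q t I F = Mfps (\<lambda>m.
     (\<Prod>i\<in>I. svar i * cst (t powi (int i - int n)) * cst (q powi (- wt m i))) * mcoeff F m)"

definition RM_op :: "nat \<Rightarrow> complex \<Rightarrow> complex \<Rightarrow> nat \<Rightarrow> ratfun mfps \<Rightarrow> ratfun mfps" where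
  "RM_op n q t r F = mconst (cst (t ^ (r choose 2))) *
     (\<Sum>I | I \<subseteq> {1..n} \<and> card I = r.
        (\<Prod>i\<in>I. \<Prod>j\<in>{1..n} - I. RM_factor t i j) * q_shift n q t I F)"

text \<open>
  The generating operator \<open>D\<^sup>x(u) = \<Sum>\<^sub>r (-u)\<^sup>r D\<^sub>r\<^sup>x\<close> takes values in series whose coefficients are
  polynomials in the indeterminate \<open>u\<close> over \<open>\<complex>(s)\<close>.
\<close>

abbreviation uvar :: "ratfun poly mfps" where
  "uvar \<equiv> mconst [:0, 1:]"

abbreviation ulift :: "ratfun mfps \<Rightarrow> ratfun poly mfps" where
  "ulift \<equiv> map_mfps (\<lambda>c. [:c:])"

definition RM_gen :: "nat \<Rightarrow> complex \<Rightarrow> complex \<Rightarrow> ratfun mfps \<Rightarrow> ratfun poly mfps" where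
  "RM_gen n q t F = (\<Sum>r\<le>n. (- uvar) ^ r * ulift (RM_op n q t r F))"

text \<open>
  \<open>\<phi> \<in> \<complex>(s\<^sup>-\<^sup>Q\<^sup>+)[[x\<^sup>-\<^sup>Q\<^sup>+]]\<close> has leading coefficient 1 and \<open>f = x\<^sup>\<lambda> \<phi>\<close> satisfies
  \<open>D\<^sup>x(u) f = f \<Prod>\<^sub>i (1 - u s\<^sub>i)\<close>.
\<close>

definition RM_eigenseries :: "nat \<Rightarrow> complex \<Rightarrow> complex \<Rightarrow> ratfun mfps \<Rightarrow> bool" where
  "RM_eigenseries n q t \<phi> \<longleftrightarrow>
     \<phi> \<in> xseries n \<and> mcoeff \<phi> 0 = 1 \<and>
     RM_gen n q t \<phi> = ulift \<phi> * (\<Prod>i=1..n. 1 - uvar * mconst [:svar i:])"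


section \<open>The normalizing product\<close>

definition qpoch_inf :: "complex \<Rightarrow> complex \<Rightarrow> complex" where
  "qpoch_inf z q = prodinf (\<lambda>k. 1 - q ^ k * z)"

text \<open>Power series expansion of \<open>(qX;q)\<^sub>\<infinity> / (qX/t;q)\<^sub>\<infinity>\<close> at \<open>X = 0\<close>.\<close>

definition norm_fps :: "complex \<Rightarrow> complex \<Rightarrow> complex fps" where
  "norm_fps q t =
     fps_expansion (\<lambda>X. qpoch_inf (q * X) q) 0 / fps_expansion (\<lambda>X. qpoch_inf (q * X / t) q) 0"

definition norm_prod :: "nat \<Rightarrow> complex \<Rightarrow> complex \<Rightarrow> ratfun mfps" where
  "norm_prod n q t =
     (\<Prod>(i, j)\<in>{(i, j). 1 \<le> i \<and> i < j \<and> j \<le> n}. at_ratio i j (norm_fps q t))"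

end

theory Submission
  imports Defs
begin

text \<open>
  Let \<open>G(X) = (qX;q)\<^sub>\<infinity> / (qX/t;q)\<^sub>\<infinity>\<close>, so that \<open>G(qX) / G(X) = (1 - qX/t) / (1 - qX)\<close>.  Conjugating the
  operator \<open>D\<^sup>x(u)\<close> by \<open>\<Prod>\<^sub>i\<^sub><\<^sub>j G(x\<^sub>j/x\<^sub>i)\<close> turns the coefficient of a pair \<open>i < j\<close> with \<open>i \<in> I\<close>, \<open>j \<notin> I\<close>
  into the constant \<open>t\<close>, and that of a pair with \<open>i \<notin> I\<close>, \<open>j \<in> I\<close> into
  \<open>(1 - tX)(1 - qX/t) / ((1 - X)(1 - qX))\<close> with \<open>X = x\<^sub>j/x\<^sub>i\<close>; the constants cancel the powers of \<open>t\<close> in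
  \<open>D\<^sub>r\<^sup>x\<close> and in \<open>T\<^sub>q\<^sub>,\<^sub>x\<^sub>i x\<^sup>\<lambda>\<close>.  The resulting equation for \<open>\<psi>\<close> is visibly symmetric under \<open>t \<leftrightarrow> q/t\<close>,
  and it determines \<open>\<psi>\<close> from its leading coefficient: \<open>\<psi>\<^sub>\<mu>\<close> enters with the factor
  \<open>\<Prod>\<^sub>i (1 - u s\<^sub>i q\<^sup>-\<^sup>\<mu>\<^sup>i) - \<Prod>\<^sub>i (1 - u s\<^sub>i)\<close>, which is a nonzero polynomial in \<open>u\<close> for \<open>\<mu> \<noteq> 0\<close>.
\<close>

section \<open>Formal power series in several variables\<close>

lemma splits_0 [simp]: "splits 0 = {(0, 0)}"
proof -
  have "a + b = 0 \<longleftrightarrow> a = 0 \<and> b = 0" for a b :: "nat \<Rightarrow>\<^sub>0 nat"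
    by (auto simp: poly_mapping_eq_iff fun_eq_iff lookup_add)
  then show ?thesis by (auto simp: splits_def)
qed

lemma mcoeff_mult_0 [simp]: "mcoeff (F * G) 0 = mcoeff F 0 * mcoeff G 0"
  by (simp add: mcoeff_mult)

lemma mcoeff_prod_0:
  fixes F :: "'a \<Rightarrow> 'b::comm_ring_1 mfps"
  shows "mcoeff (\<Prod>x\<in>A. F x) 0 = (\<Prod>x\<in>A. mcoeff (F x) 0)"
  by (induction A rule: infinite_finite_induct) (simp_all add: mcoeff_one)

lemma mcoeff_sum: "mcoeff (\<Sum>x\<in>A. F x) m = (\<Sum>x\<in>A. mcoeff (F x :: 'b::comm_ring_1 mfps) m)"
  by (induction A rule: infinite_finite_induct) simp_all

text \<open>Dropping the splitting with \<open>a = 0\<close> leaves the terms of a Cauchy product in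
  which the second factor contributes only exponents of smaller total degree. This drives the
  coefficient recursions below.\<close>

definition proper_splits :: "(nat \<Rightarrow>\<^sub>0 nat) \<Rightarrow> ((nat \<Rightarrow>\<^sub>0 nat) \<times> (nat \<Rightarrow>\<^sub>0 nat)) set" where
  "proper_splits m = {(a, b). a + b = m \<and> a \<noteq> 0}"

lemma mcoeff_mult_split:
  fixes F G :: "'a::comm_ring_1 mfps"
  shows "mcoeff (F * G) m = mcoeff F 0 * mcoeff G m
           + (\<Sum>(a, b)\<in>proper_splits m. mcoeff F a * mcoeff G b)"
proof -
  have "splits m - {(0, m)} = proper_splits m"
    by (auto simp: splits_def proper_splits_def)
  moreover have "(0, m) \<in> splits m"
    by (simp add: splits_def)
  ultimately show ?thesis
    unfolding mcoeff_mult by (simp add: sum.remove)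
qed

text \<open>Well-founded because the total degree drops: \<open>b\<close> arises from
  \<open>m\<close> by removing a nonzero \<open>a\<close>.\<close>

lemma proper_splits_induct:
  assumes "\<And>m. (\<And>a b. (a, b) \<in> proper_splits m \<Longrightarrow> P b) \<Longrightarrow> P m"
  shows "P m"
proof (induction "\<Sum>x\<in>Poly_Mapping.keys m. Poly_Mapping.lookup m x" arbitrary: m rule: less_induct)
  case less
  show ?case
  proof (rule assms)
    fix a b assume "(a, b) \<in> proper_splits m"
    then have m: "m = a + b" and "a \<noteq> 0" by (auto simp: proper_splits_def)
    then obtain x where x: "Poly_Mapping.lookup a x \<noteq> 0"
      by (metis poly_mapping_eqI lookup_zero)
    let ?K = "Poly_Mapping.keys m"
    have sub: "Poly_Mapping.keys b \<subseteq> ?K"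
      by (auto simp: m in_keys_iff lookup_add)
    have "(\<Sum>x\<in>Poly_Mapping.keys b. Poly_Mapping.lookup b x) = (\<Sum>x\<in>?K. Poly_Mapping.lookup b x)"
      using sub by (intro sum.mono_neutral_left) (auto simp: in_keys_iff)
    also have "\<dots> < (\<Sum>x\<in>?K. Poly_Mapping.lookup m x)"
    proof (rule sum_strict_mono_ex1)
      have "x \<in> ?K" using x by (simp add: m in_keys_iff lookup_add)
      then show "\<exists>x\<in>?K. Poly_Mapping.lookup b x < Poly_Mapping.lookup m x"
        using x by (intro bexI[of _ x]) (simp_all add: m lookup_add)
    qed (simp_all add: m lookup_add)
    finally show "P b" by (rule less)
  qed
qed

text \<open>Coefficients are recovered from the bottom up. Constant term 1 avoids division, so any
  commutative coefficient ring will do.\<close>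

lemma mfps_mult_left_cancel:
  fixes N F G :: "'a::comm_ring_1 mfps"
  assumes "mcoeff N 0 = 1" "N * F = N * G"
  shows "F = G"
proof (rule mfps_eqI)
  fix m show "mcoeff F m = mcoeff G m"
  proof (induction m rule: proper_splits_induct)
    case (1 m)
    have "(\<Sum>(a, b)\<in>proper_splits m. mcoeff N a * mcoeff F b)
        = (\<Sum>(a, b)\<in>proper_splits m. mcoeff N a * mcoeff G b)"
      using 1 by (intro sum.cong) auto
    with assms(2) show ?case
      using mcoeff_mult_split[of N F m] mcoeff_mult_split[of N G m] assms(1) by simp
  qed
qed

lemma mcoeff_mconst_mult [simp]: "mcoeff (mconst c * F) m = (c::'a::comm_ring_1) * mcoeff F m"
  unfolding mcoeff_mult_split
  by (subst sum.neutral) (auto simp: mconst_def proper_splits_def)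

lemma mconst_mult: "mconst (a * b) = mconst a * mconst (b::'a::comm_ring_1)"
  by (rule mfps_eqI) (simp, simp add: mconst_def)

lemma mconst_1 [simp]: "mconst (1::'a::comm_ring_1) = 1"
  by (rule mfps_eqI) (simp add: mconst_def mcoeff_one)

lemma mconst_uminus: "mconst (- a) = - mconst (a::'a::comm_ring_1)"
  by (rule mfps_eqI) (simp add: mconst_def)

lemma mconst_diff: "mconst (a - b) = mconst a - mconst (b::'a::comm_ring_1)"
  by (rule mfps_eqI) (simp add: mconst_def)

lemma mconst_prod: "mconst (\<Prod>x\<in>A. f x) = (\<Prod>x\<in>A. mconst (f x :: 'a::comm_ring_1))"
  by (induction A rule: infinite_finite_induct) (simp_all add: mconst_mult)

lemma mconst_power: "mconst (a ^ k) = mconst (a::'a::comm_ring_1) ^ k"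
  by (induction k) (simp_all add: mconst_mult)

text \<open>Products of shifts act diagonally on monomials. If \<open>h\<close> is multiplicative on
  exponents, the operator respects products of series.\<close>

definition mscale :: "((nat \<Rightarrow>\<^sub>0 nat) \<Rightarrow> 'k) \<Rightarrow> 'k mfps \<Rightarrow> 'k::times mfps" where
  "mscale h F = Mfps (\<lambda>m. h m * mcoeff F m)"

lemma mcoeff_mscale [simp]: "mcoeff (mscale h F) m = h m * mcoeff F m"
  by (simp add: mscale_def)

context
  fixes h :: "(nat \<Rightarrow>\<^sub>0 nat) \<Rightarrow> 'k::comm_ring_1"
  assumes h_0: "h 0 = 1" and h_add: "\<And>a b. h (a + b) = h a * h b"
begin

lemma mscale_mult: "mscale h (F * G) = mscale h F * mscale h G"
proof (rule mfps_eqI)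
  fix m
  have "h m * (case x of (a, b) \<Rightarrow> mcoeff F a * mcoeff G b)
      = (case x of (a, b) \<Rightarrow> h a * mcoeff F a * (h b * mcoeff G b))" if "x \<in> splits m" for x
    using that by (auto simp: splits_def h_add)
  then show "mcoeff (mscale h (F * G)) m = mcoeff (mscale h F * mscale h G) m"
    by (simp add: mcoeff_mult sum_distrib_left)
qed

lemma mscale_prod: "mscale h (\<Prod>x\<in>A. F x) = (\<Prod>x\<in>A. mscale h (F x))"
proof (induction A rule: infinite_finite_induct)
  case empty
  show ?case by (rule mfps_eqI) (simp add: mcoeff_one h_0)
next
  case (infinite A)
  then show ?case by (auto intro: mfps_eqI simp: mcoeff_one h_0)
qed (simp_all add: mscale_mult)

end

section \<open>Coefficientwise ring homomorphisms, for specializing \<open>u\<close>\<close>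

context
  fixes h :: "'a::comm_ring_1 \<Rightarrow> 'b::comm_ring_1"
  assumes h_0: "h 0 = 0" and h_1: "h 1 = 1" and h_add: "\<And>x y. h (x + y) = h x + h y"
    and h_mult: "\<And>x y. h (x * y) = h x * h y"
begin

lemma map_mfps_1: "map_mfps h 1 = 1"
  by (rule mfps_eqI) (simp add: map_mfps_def mcoeff_one h_0 h_1)

lemma map_mfps_mult: "map_mfps h (F * G) = map_mfps h F * map_mfps h G"
proof (rule mfps_eqI)
  have *: "h (sum f A) = (\<Sum>x\<in>A. h (f x))" for f :: "'z \<Rightarrow> 'a" and A
    by (induction A rule: infinite_finite_induct) (simp_all add: h_0 h_add)
  fix m show "mcoeff (map_mfps h (F * G)) m = mcoeff (map_mfps h F * map_mfps h G) m"
    by (simp add: map_mfps_def mcoeff_mult * h_mult case_prod_unfold)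
qed

lemma map_mfps_sum: "map_mfps h (\<Sum>x\<in>A. F x) = (\<Sum>x\<in>A. map_mfps h (F x))"
proof (induction A rule: infinite_finite_induct)
  case (insert x A)
  have "map_mfps h (F + G) = map_mfps h F + map_mfps h G" for F G
    by (rule mfps_eqI) (simp add: map_mfps_def h_add)
  with insert show ?case by simp
qed (auto intro!: mfps_eqI simp: map_mfps_def h_0)

lemma map_mfps_power: "map_mfps h (F ^ k) = map_mfps h F ^ k"
  by (induction k) (simp_all add: map_mfps_1 map_mfps_mult)

lemma map_mfps_mconst: "map_mfps h (mconst c) = mconst (h c)"
  by (rule mfps_eqI) (simp add: map_mfps_def mconst_def h_0)

end

section \<open>Spectral variables and their rational functions\<close>

lemma cst_0 [simp]: "cst 0 = 0" and cst_1 [simp]: "cst 1 = 1"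
  by (simp_all add: cst_def Zero_fract_def One_fract_def)

lemma cst_add: "cst (a + b) = cst a + cst b"
  by (simp add: cst_def single_add)

lemma cst_mult: "cst (a * b) = cst a * cst b"
  by (simp add: cst_def mult_single)

lemma cst_sum: "cst (\<Sum>x\<in>A. f x) = (\<Sum>x\<in>A. cst (f x))"
  by (induction A rule: infinite_finite_induct) (simp_all add: cst_add)

lemma cst_prod: "cst (\<Prod>x\<in>A. f x) = (\<Prod>x\<in>A. cst (f x))"
  by (induction A rule: infinite_finite_induct) (simp_all add: cst_mult)

lemma svar_nonzero [simp]: "svar i \<noteq> 0"
proof -
  have "Poly_Mapping.single (Poly_Mapping.single i (1::nat)) (1::complex) \<noteq> 0"
    by (metis lookup_single_eq lookup_zero zero_neq_one)
  then show ?thesis by (simp add: svar_def Zero_fract_def eq_fract)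
qed
text \<open>Both sides are single monomials over denominator 1, so supports and coefficients can be
  compared. This later excludes a zero factor in the recursion for \<open>\<psi>\<close>.\<close>

lemma cst_svar_eqD:
  assumes "svar j * cst c = svar i"
  shows "j = i \<and> c = 1"
proof -
  have eq: "Poly_Mapping.single (Poly_Mapping.single j (1::nat)) c = Poly_Mapping.single (Poly_Mapping.single i 1) 1"
    using assms by (simp add: svar_def cst_def eq_fract mult_single)
  have "c \<noteq> 0" using eq by (metis lookup_single_eq lookup_zero single_zero zero_neq_one)
  then have "Poly_Mapping.single j (1::nat) = Poly_Mapping.single i 1"
    using arg_cong[OF eq, of Poly_Mapping.keys] by simp
  then have ji: "j = i"
    by (metis lookup_single_eq lookup_single_not_eq zero_neq_one)
  moreover have "c = 1"
    using arg_cong[OF eq, of "\<lambda>f. Poly_Mapping.lookup f (Poly_Mapping.single i 1)"] by (simp add: ji)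
  ultimately show ?thesis by simp
qed

section \<open>Closure properties of the series ring\<close>

lemma Qplus_add_iff: "a + b \<in> Qplus n \<longleftrightarrow> a \<in> Qplus n \<and> b \<in> Qplus n"
  by (auto simp: Qplus_def in_keys_iff lookup_add subset_eq)

lemma ratio_field_sum: "(\<And>x. x \<in> A \<Longrightarrow> f x \<in> ratio_field n) \<Longrightarrow> sum f A \<in> ratio_field n"
  by (induction A rule: infinite_finite_induct)
    (use ratio_field.cst[of 0] in \<open>auto intro: ratio_field.add\<close>)

lemma xseries_mcoeff: "F \<in> xseries n \<Longrightarrow> mcoeff F m \<in> ratio_field n"
  using ratio_field.cst[of 0] by (cases "m \<in> Qplus n") (auto simp: xseries_def)

lemma xseries_1 [simp]: "1 \<in> xseries n"
  using ratio_field.cst[of 0] ratio_field.cst[of 1] by (auto simp: xseries_def mcoeff_one Qplus_def)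

lemma xseries_mult:
  assumes "F \<in> xseries n" "G \<in> xseries n"
  shows "F * G \<in> xseries n"
proof -
  have "mcoeff (F * G) m \<in> ratio_field n" for m
    unfolding mcoeff_mult using assms
    by (intro ratio_field_sum) (auto intro: ratio_field.mult xseries_mcoeff)
  moreover have "mcoeff (F * G) m = 0" if "m \<notin> Qplus n" for m
    unfolding mcoeff_mult
    using assms that by (intro sum.neutral) (auto simp: splits_def Qplus_add_iff xseries_def)
  ultimately show ?thesis by (auto simp: xseries_def)
qed

lemma xseries_prod: "(\<And>x. x \<in> A \<Longrightarrow> F x \<in> xseries n) \<Longrightarrow> (\<Prod>x\<in>A. F x) \<in> xseries n"
  by (induction A rule: infinite_finite_induct) (auto intro: xseries_mult)

text \<open>The recursion expresses a coefficient of \<open>F\<close> through \<open>N * F\<close>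
  and lower coefficients of \<open>F\<close> by ring operations, so it stays in
  \<open>ratio_field n\<close>. An exponent outside \<open>Qplus n\<close> always splits with a part
  outside.\<close>

lemma xseries_mult_cancel:
  assumes N: "N \<in> xseries n" "mcoeff N 0 = 1" and NF: "N * F \<in> xseries n"
  shows "F \<in> xseries n"
proof -
  have "mcoeff F m \<in> ratio_field n \<and> (m \<notin> Qplus n \<longrightarrow> mcoeff F m = 0)" for m
  proof (induction m rule: proper_splits_induct)
    case (1 m)
    let ?S = "\<Sum>(a, b)\<in>proper_splits m. mcoeff N a * mcoeff F b"
    have F: "mcoeff F m = mcoeff (N * F) m + - ?S"
      by (simp add: mcoeff_mult_split N)
    have "?S \<in> ratio_field n"
      using 1 by (intro ratio_field_sum) (auto intro!: ratio_field.mult xseries_mcoeff[OF N(1)])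
    moreover have "?S = 0" if "m \<notin> Qplus n"
    proof (rule sum.neutral, safe)
      fix a b assume ab: "(a, b) \<in> proper_splits m"
      then have "a \<notin> Qplus n \<or> b \<notin> Qplus n" using that by (auto simp: proper_splits_def Qplus_add_iff)
      then show "mcoeff N a * mcoeff F b = 0" using 1[OF ab] N(1) by (auto simp: xseries_def)
    qed
    ultimately show ?case
      unfolding F using ratio_field.add[OF xseries_mcoeff[OF NF] ratio_field.uminus] NF
      by (simp add: xseries_def)
  qed
  then show ?thesis by (auto simp: xseries_def)
qed

section \<open>Substitution of a ratio of $x$-variables\<close>

text \<open>Exponent vector of \<open>(x_j/x_i)^k\<close>, as the ratio is the product of the
  \<open>z_a\<close> with \<open>i <= a < j\<close>.\<close>

definition ratio_exp :: "nat \<Rightarrow> nat \<Rightarrow> nat \<Rightarrow> (nat \<Rightarrow>\<^sub>0 nat)" where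
  "ratio_exp i j k = (\<Sum>a\<in>{i..<j}. Poly_Mapping.single a k)"

lemma lookup_ratio_exp:
  "Poly_Mapping.lookup (ratio_exp i j k) a = (if i \<le> a \<and> a < j then k else 0)"
  by (auto simp: ratio_exp_def lookup_sum lookup_single when_def)

lemma ratio_exp_add: "ratio_exp i j (k + l) = ratio_exp i j k + ratio_exp i j l"
  by (rule poly_mapping_eqI) (simp add: lookup_ratio_exp lookup_add)

lemma ratio_exp_eq_iff: "i < j \<Longrightarrow> ratio_exp i j k = ratio_exp i j l \<longleftrightarrow> k = l"
  by (metis lookup_ratio_exp order_refl)

lemma mcoeff_at_ratio_exp [simp]:
  "i < j \<Longrightarrow> mcoeff (at_ratio i j F) (ratio_exp i j k) = cst (fps_nth F k)"
  by (simp add: at_ratio_def lookup_ratio_exp)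

lemma mcoeff_at_ratio_eq_0:
  assumes "i < j" "m \<notin> range (ratio_exp i j)"
  shows "mcoeff (at_ratio i j F) m = 0"
proof -
  have "m = ratio_exp i j (Poly_Mapping.lookup m i)"
    if "\<forall>a. Poly_Mapping.lookup m a = (if i \<le> a \<and> a < j then Poly_Mapping.lookup m i else 0)"
    by (rule poly_mapping_eqI, subst lookup_ratio_exp) (use that in blast)
  with assms(2) show ?thesis unfolding at_ratio_def mcoeff_Mfps Let_def by (metis rangeI)
qed

lemma mcoeff_at_ratio_0 [simp]: "i < j \<Longrightarrow> mcoeff (at_ratio i j F) 0 = cst (fps_nth F 0)"
  by (simp add: at_ratio_def)

lemma at_ratio_const: 
  assumes "i < j" shows "at_ratio i j (fps_const c) = mconst (cst c)"
proof (rule mfps_eqI)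
  fix m
  have z: "ratio_exp i j 0 = 0" by (simp add: ratio_exp_def)
  show "mcoeff (at_ratio i j (fps_const c)) m = mcoeff (mconst (cst c)) m"
  proof (cases "m \<in> range (ratio_exp i j)")
    case True
    then obtain k where m: "m = ratio_exp i j k" by auto
    show ?thesis unfolding m using ratio_exp_eq_iff[OF assms, of k 0] assms by (simp add: mconst_def z)
  next
    case False
    then have "m \<noteq> 0" using z by (metis rangeI)
    with mcoeff_at_ratio_eq_0[OF assms False] show ?thesis by (simp add: mconst_def)
  qed
qed

text \<open>Coefficients vanish off the multiples of the substituted exponent, so the splittings
  that count are the pairs \<open>(l, k - l)\<close> of the one-variable Cauchy product.\<close>

lemma at_ratio_mult:
  assumes "i < j"
  shows "at_ratio i j (F * G) = at_ratio i j F * at_ratio i j G"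
proof (rule mfps_eqI)
  fix m
  let ?e = "ratio_exp i j" and ?c = "\<lambda>(a, b). mcoeff (at_ratio i j F) a * mcoeff (at_ratio i j G) b"
  have vanish: "?c (a, b) = 0" if "a \<notin> range ?e \<or> b \<notin> range ?e" for a b
    using mcoeff_at_ratio_eq_0[OF assms] that by auto
  show "mcoeff (at_ratio i j (F * G)) m = mcoeff (at_ratio i j F * at_ratio i j G) m"
  proof (cases "m \<in> range ?e")
    case True
    then obtain k where m: "m = ?e k" by auto
    have "sum ?c (splits m) = sum ?c ((\<lambda>l. (?e l, ?e (k - l))) ` {0..k})"
    proof (rule sum.mono_neutral_right)
      show "(\<lambda>l. (?e l, ?e (k - l))) ` {0..k} \<subseteq> splits m"
        by (auto simp: splits_def m simp flip: ratio_exp_add)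
      show "\<forall>x\<in>splits m - (\<lambda>l. (?e l, ?e (k - l))) ` {0..k}. ?c x = 0"
      proof
        fix x assume x: "x \<in> splits m - (\<lambda>l. (?e l, ?e (k - l))) ` {0..k}"
        obtain a b where ab: "x = (a, b)" by (cases x)
        have "a \<notin> range ?e \<or> b \<notin> range ?e"
        proof (rule ccontr)
          assume "\<not> ?thesis"
          then obtain l l' where l: "a = ?e l" "b = ?e l'" by auto
          then have "k = l + l'"
            using x assms by (auto simp: ab splits_def m ratio_exp_eq_iff simp flip: ratio_exp_add)
          with x l show False by (force simp: ab)
        qed
        with vanish ab show "?c x = 0" by simp
      qed
    qed simp
    also have "\<dots> = (\<Sum>l=0..k. ?c (?e l, ?e (k - l)))"
      by (subst sum.reindex) (auto simp: inj_on_def ratio_exp_eq_iff[OF assms])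
    finally show ?thesis
      using assms by (simp add: mcoeff_mult m fps_mult_nth cst_sum cst_mult)
  next
    case False
    have "a \<notin> range ?e \<or> b \<notin> range ?e" if "(a, b) \<in> splits m" for a b
    proof (rule ccontr)
      assume "\<not> ?thesis"
      then obtain l l' where "a = ?e l" "b = ?e l'" by auto
      with that have "m = ?e (l + l')" by (auto simp: splits_def ratio_exp_add)
      with False show False by auto
    qed
    then have "sum ?c (splits m) = 0"
      using vanish by (intro sum.neutral) fastforce
    then show ?thesis
      using mcoeff_at_ratio_eq_0[OF assms False] by (simp add: mcoeff_mult)
  qed
qed

lemma at_ratio_xseries:
  assumes "1 \<le> i" "i < j" "j \<le> n"
  shows "at_ratio i j F \<in> xseries n"
proof -
  have "ratio_exp i j k \<in> Qplus n" for k
    using assms by (auto simp: Qplus_def in_keys_iff lookup_ratio_exp split: if_splits)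
  then have "mcoeff (at_ratio i j F) m = 0" if "m \<notin> Qplus n" for m
    using that by (intro mcoeff_at_ratio_eq_0[OF assms(2)]) blast
  moreover have "mcoeff (at_ratio i j F) m \<in> ratio_field n" for m
  proof (cases "m \<in> range (ratio_exp i j)")
    case True
    then show ?thesis using assms(2) by (auto intro: ratio_field.cst)
  next
    case False
    then show ?thesis using ratio_field.cst[of 0] mcoeff_at_ratio_eq_0[OF assms(2) False] by simp
  qed
  ultimately show ?thesis by (simp add: xseries_def)
qed

section \<open>The normalizing power series\<close>

text \<open>The values \<open>c = q\<close> and \<open>c = q / t\<close> give numerator and
  denominator of \<open>norm_fps\<close>.\<close>

definition qpoch_fps :: "complex \<Rightarrow> complex \<Rightarrow> complex fps" where
  "qpoch_fps q c = fps_expansion (\<lambda>X. qpoch_inf (c * X) q) 0"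

lemma norm_fps_eq: "norm_fps q t = qpoch_fps q q / qpoch_fps q (q / t)"
  by (simp add: norm_fps_def qpoch_fps_def)

context
  fixes q :: complex
  assumes q: "norm q < 1"
begin

text \<open>Weierstrass test with majorant \<open>R * norm q ^ k\<close>. Uniformity on balls of
  every radius makes the infinite product entire.\<close>

lemma qpoch_inf_uniform_limit:
  "uniform_limit (cball 0 R) (\<lambda>N z. \<Prod>k<N. 1 - q ^ k * z) (\<lambda>z. qpoch_inf z q) sequentially"
proof -
  have "uniformly_convergent_on (cball 0 R) (\<lambda>N z. \<Prod>k<N. 1 - q ^ k * z)"
  proof (rule uniformly_convergent_on_prod')
    show "uniformly_convergent_on (cball 0 R) (\<lambda>N z. \<Sum>k<N. norm (1 - q ^ k * z - 1))"
    proof (rule Weierstrass_m_test')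
      show "norm (norm (1 - q ^ k * z - 1)) \<le> R * norm q ^ k" if "z \<in> cball 0 R" for k z
        using that by (simp add: norm_mult norm_power mult.commute mult_right_mono)
      show "summable (\<lambda>k. R * norm q ^ k)"
        using q by (intro summable_mult summable_geometric) auto
    qed
  qed (auto intro!: continuous_intros)
  then obtain g where g: "uniform_limit (cball 0 R) (\<lambda>N z. \<Prod>k<N. 1 - q ^ k * z) g sequentially"
    by (auto simp: uniformly_convergent_on_def)
  have "g z = qpoch_inf z q" if "z \<in> cball 0 R" for z
  proof -
    have "summable (\<lambda>k. norm (1 - q ^ k * z - 1))"
      using q by (auto simp: norm_mult norm_power intro!: summable_mult2 summable_geometric)
    then have "convergent_prod (\<lambda>k. 1 - q ^ k * z)"
      by (intro abs_convergent_prod_imp_convergent_prod summable_imp_abs_convergent_prod)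
    then have "(\<lambda>N. \<Prod>k\<le>N. 1 - q ^ k * z) \<longlonglongrightarrow> qpoch_inf z q"
      unfolding qpoch_inf_def by (rule convergent_prod_LIMSEQ)
    \<comment> \<open>The infinite product is a limit of products over \<open>k <= N\<close>, the
      uniform limit one of products over \<open>k < N\<close>; hence the index shift.\<close>
    moreover have "(\<lambda>N. \<Prod>k\<le>N. 1 - q ^ k * z) \<longlonglongrightarrow> g z"
      using tendsto_uniform_limitI[OF g that]
      by (subst (asm) filterlim_sequentially_Suc[symmetric]) (simp add: lessThan_Suc_atMost)
    ultimately show ?thesis by (rule LIMSEQ_unique[THEN sym])
  qed
  then show ?thesis
    using uniform_limit_cong'[OF refl] g by (metis (no_types, lifting))
qed

lemma qpoch_inf_LIMSEQ: "(\<lambda>N. \<Prod>k<N. 1 - q ^ k * z) \<longlonglongrightarrow> qpoch_inf z q"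
  using tendsto_uniform_limitI[OF qpoch_inf_uniform_limit[of "norm z"], of z] by simp

text \<open>Split off the factor at \<open>k = 0\<close>; the others form the same product at
  \<open>q * z\<close>.\<close>

lemma qpoch_inf_rec: "qpoch_inf z q = (1 - z) * qpoch_inf (q * z) q"
proof -
  have "(\<lambda>N. \<Prod>k<Suc N. 1 - q ^ k * z) \<longlonglongrightarrow> qpoch_inf z q"
    using qpoch_inf_LIMSEQ[of z] by (rule LIMSEQ_Suc)
  also have "(\<lambda>N. \<Prod>k<Suc N. 1 - q ^ k * z) = (\<lambda>N. (1 - z) * (\<Prod>k<N. 1 - q ^ k * (q * z)))"
    by (subst prod.lessThan_Suc_shift) (simp add: mult_ac)
  finally have "(\<lambda>N. (1 - z) * (\<Prod>k<N. 1 - q ^ k * (q * z))) \<longlonglongrightarrow> qpoch_inf z q" .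
  moreover have "(\<lambda>N. (1 - z) * (\<Prod>k<N. 1 - q ^ k * (q * z))) \<longlonglongrightarrow> (1 - z) * qpoch_inf (q * z) q"
    by (intro tendsto_mult tendsto_const qpoch_inf_LIMSEQ)
  ultimately show ?thesis by (rule LIMSEQ_unique)
qed

lemma qpoch_inf_0: "qpoch_inf 0 q = 1"
  by (simp add: qpoch_inf_def)

lemma qpoch_inf_holomorphic: "(\<lambda>z. qpoch_inf z q) holomorphic_on UNIV"
proof (rule holomorphic_uniform_sequence)
  fix z :: complex
  have "uniform_limit (cball z 1) (\<lambda>N z. \<Prod>k<N. 1 - q ^ k * z) (\<lambda>z. qpoch_inf z q) sequentially"
    by (rule uniform_limit_on_subset[OF qpoch_inf_uniform_limit[of "norm z + 1"]])
      (simp add: cball_subset_cball_iff)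
  then show "\<exists>d>0. cball z d \<subseteq> UNIV \<and>
      uniform_limit (cball z d) (\<lambda>N z. \<Prod>k<N. 1 - q ^ k * z) (\<lambda>z. qpoch_inf z q) sequentially"
    by (intro exI[of _ 1]) auto
qed (auto intro!: holomorphic_intros)

lemma qpoch_fps_expansion: "(\<lambda>X. qpoch_inf (c * X) q) has_fps_expansion qpoch_fps q c"
proof -
  have "((\<lambda>z. qpoch_inf z q) \<circ> (\<lambda>X. c * X)) holomorphic_on UNIV"
    by (rule holomorphic_on_compose) (auto intro!: holomorphic_intros holomorphic_on_subset[OF qpoch_inf_holomorphic])
  then show ?thesis unfolding qpoch_fps_def by (intro has_fps_expansion_fps_expansion[of UNIV]) (auto simp: o_def)
qed

lemma qpoch_fps_nth_0: "fps_nth (qpoch_fps q c) 0 = 1"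
  by (simp add: qpoch_fps_def fps_expansion_def qpoch_inf_0)

text \<open>The functional equation of the entire function passes to its expansion by uniqueness of
  Taylor coefficients.\<close>

lemma qpoch_fps_rec:
  "qpoch_fps q c = (1 - fps_const c * fps_X) * (qpoch_fps q c oo (fps_const q * fps_X))"
proof -
  have 1: "(\<lambda>X. q * X) has_fps_expansion fps_const q * fps_X"
    by (intro fps_expansion_intros)
  have 2: "((\<lambda>X. qpoch_inf (c * X) q) \<circ> (\<lambda>X. q * X)) has_fps_expansion
      (qpoch_fps q c oo (fps_const q * fps_X))"
    by (rule has_fps_expansion_compose[OF qpoch_fps_expansion 1]) simp
  have 3: "(\<lambda>X. 1 - c * X) has_fps_expansion 1 - fps_const c * fps_X"
    by (intro fps_expansion_intros)
  have "(\<lambda>X. (1 - c * X) * ((\<lambda>X. qpoch_inf (c * X) q) \<circ> (\<lambda>X. q * X)) X) has_fps_expansion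
      (1 - fps_const c * fps_X) * (qpoch_fps q c oo (fps_const q * fps_X))"
    by (rule has_fps_expansion_mult[OF 3 2])
  also have "(\<lambda>X. (1 - c * X) * ((\<lambda>X. qpoch_inf (c * X) q) \<circ> (\<lambda>X. q * X)) X) = (\<lambda>X. qpoch_inf (c * X) q)"
    by (rule ext, subst (2) qpoch_inf_rec) (simp add: mult_ac)
  finally show ?thesis
    using fps_expansion_unique_complex qpoch_fps_expansion by blast
qed

lemma norm_fps_mult: "norm_fps q t * qpoch_fps q (q / t) = qpoch_fps q q"
proof -
  have "fps_nth (qpoch_fps q (q / t)) 0 \<noteq> 0" by (simp add: qpoch_fps_nth_0)
  then have "is_unit (qpoch_fps q (q / t))" by simp
  then have "qpoch_fps q (q / t) dvd qpoch_fps q q" by (rule unit_imp_dvd)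
  then show ?thesis
    by (simp add: norm_fps_eq)
qed

lemma norm_fps_nth_0: "fps_nth (norm_fps q t) 0 = 1"
  using arg_cong[OF norm_fps_mult[of t], of "\<lambda>F. fps_nth F 0"] by (simp add: qpoch_fps_nth_0)

text \<open>Quotient of the recursions for \<open>c = q\<close> and \<open>c = q / t\<close>,
  cleared of denominators.\<close>

lemma norm_fps_dilate:
  "(norm_fps q t oo (fps_const q * fps_X)) * (1 - fps_const q * fps_X)
     = norm_fps q t * (1 - fps_const (q / t) * fps_X)"
proof -
  let ?d = "\<lambda>F. F oo (fps_const q * fps_X)" and ?G = "norm_fps q t"
  have "fps_nth (?d (qpoch_fps q (q / t))) 0 = 1"
    by (simp add: qpoch_fps_nth_0)
  then have nz: "?d (qpoch_fps q (q / t)) \<noteq> 0" by force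
  have "?d ?G * (1 - fps_const q * fps_X) * ?d (qpoch_fps q (q / t))
      = (1 - fps_const q * fps_X) * ?d (?G * qpoch_fps q (q / t))"
    by (simp add: fps_compose_mult_distrib mult_ac)
  also have "\<dots> = ?G * qpoch_fps q (q / t)"
    unfolding norm_fps_mult using qpoch_fps_rec[of q] by simp
  also have "\<dots> = ?G * ((1 - fps_const (q / t) * fps_X) * ?d (qpoch_fps q (q / t)))"
    using qpoch_fps_rec[of "q / t"] by simp
  also have "\<dots> = ?G * (1 - fps_const (q / t) * fps_X) * ?d (qpoch_fps q (q / t))"
    by (simp add: mult.assoc)
  finally show ?thesis using nz by simp
qed

text \<open>The previous identity with \<open>X / q\<close> in place of \<open>X\<close>, for shifts
  of the variable in the denominator of the ratio.\<close>

lemma norm_fps_contract: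
  assumes "q \<noteq> 0"
  shows "(norm_fps q t oo (fps_const (inverse q) * fps_X)) * (1 - fps_const (inverse t) * fps_X)
     = norm_fps q t * (1 - fps_X)"
proof -
  let ?d = "\<lambda>F::complex fps. F oo (fps_const (inverse q) * fps_X)" and ?G = "norm_fps q t"
  have inv: "?d (?G oo (fps_const q * fps_X)) = ?G"
    using assms by (simp add: fps_compose_linear fps_eq_iff flip: power_mult_distrib mult.assoc)
  have lin: "?d (1 - fps_const c * fps_X) = 1 - fps_const (c / q) * fps_X" for c
    by (simp add: fps_compose_sub_distrib fps_compose_mult_distrib divide_inverse flip: fps_const_mult)
  show ?thesis
    using arg_cong[OF norm_fps_dilate[of t], of ?d] assms
    by (simp add: fps_compose_mult_distrib inv lin divide_inverse)
qed

end

section \<open>Action of the shifts on functions of a ratio\<close>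

lemma power_int_sum:
  fixes q :: "'a::field"
  assumes "q \<noteq> 0"
  shows "q powi (\<Sum>x\<in>A. f x) = (\<Prod>x\<in>A. q powi f x)"
  by (induction A rule: infinite_finite_induct) (simp_all add: power_int_add assms)

text \<open>The factor by which \<open>\<Prod>\<^sub>i\<^sub>\<in>\<^sub>I T\<^sub>q\<^sub>,\<^sub>x\<^sub>i\<close> multiplies the monomial \<open>x\<^sup>-\<^sup>\<mu>\<close>.\<close>

definition qtwist :: "complex \<Rightarrow> nat set \<Rightarrow> (nat \<Rightarrow>\<^sub>0 nat) \<Rightarrow> ratfun" where
  "qtwist q I m = (\<Prod>i\<in>I. cst (q powi (- wt m i)))"

lemma qtwist_0: "qtwist q I 0 = 1"
  by (simp add: qtwist_def wt_def)

lemma qtwist_add: "q \<noteq> 0 \<Longrightarrow> qtwist q I (a + b) = qtwist q I a * qtwist q I b"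
proof -
  assume q: "q \<noteq> 0"
  have "- wt (a + b) i = - wt a i + - wt b i" for i
    by (simp add: wt_def lookup_add)
  then show ?thesis
    unfolding qtwist_def prod.distrib[symmetric]
    by (intro prod.cong refl) (metis cst_mult power_int_add q)
qed

text \<open>The weight of \<open>(x_j/x_i)^k\<close> is \<open>k\<close> at \<open>i\<close>,
  \<open>-k\<close> at \<open>j\<close> and zero elsewhere, so only the membership of
  \<open>i\<close> and \<open>j\<close> in \<open>I\<close> matters.\<close>

lemma qtwist_ratio_exp:
  assumes "q \<noteq> 0" "I \<subseteq> {1..n}" "1 \<le> i" "i < j"
  shows "qtwist q I (ratio_exp i j k) = cst ((q powi (of_bool (j \<in> I) - of_bool (i \<in> I))) ^ k)"
proof -
  have fin: "finite I" using assms(2) finite_subset by blast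
  have "(\<Sum>l\<in>I. - wt (ratio_exp i j k) l)
      = (\<Sum>l\<in>I. (if l = j then int k else 0) - (if l = i then int k else 0))"
    using assms by (intro sum.cong) (auto simp: wt_def lookup_ratio_exp)
  also have "\<dots> = (of_bool (j \<in> I) - of_bool (i \<in> I)) * int k"
    by (simp add: sum_subtractf fin)
  finally have "(\<Sum>l\<in>I. - wt (ratio_exp i j k) l) = (of_bool (j \<in> I) - of_bool (i \<in> I)) * int k" .
  then have "q powi (\<Sum>l\<in>I. - wt (ratio_exp i j k) l) = (q powi (of_bool (j \<in> I) - of_bool (i \<in> I))) ^ k"
    by (simp only: power_int_mult power_int_of_nat)
  then show ?thesis
    by (simp only: qtwist_def cst_prod[symmetric] power_int_sum[OF assms(1)])
qed

lemma mscale_at_ratio: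
  assumes "q \<noteq> 0" "I \<subseteq> {1..n}" "1 \<le> i" "i < j"
  shows "mscale (qtwist q I) (at_ratio i j F)
    = at_ratio i j (F oo (fps_const (q powi (of_bool (j \<in> I) - of_bool (i \<in> I))) * fps_X))"
proof (rule mfps_eqI)
  fix m
  show "mcoeff (mscale (qtwist q I) (at_ratio i j F)) m = mcoeff (at_ratio i j
      (F oo (fps_const (q powi (of_bool (j \<in> I) - of_bool (i \<in> I))) * fps_X))) m"
  proof (cases "m \<in> range (ratio_exp i j)")
    case True
    then obtain k where m: "m = ratio_exp i j k" by auto
    show ?thesis
      unfolding m mcoeff_mscale qtwist_ratio_exp[OF assms] mcoeff_at_ratio_exp[OF assms(4)]
      by (simp only: fps_compose_linear fps_nth_Abs_fps cst_mult)
  next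
    case False
    then show ?thesis by (simp add: mcoeff_at_ratio_eq_0[OF assms(4)])
  qed
qed

text \<open>Coefficient of a pair with \<open>i\<close> outside and \<open>j\<close> inside
  \<open>I\<close> in the equation for \<open>\<psi>\<close>. The parameters \<open>t\<close> and
  \<open>q / t\<close> enter symmetrically.\<close>

definition cross_fps :: "complex \<Rightarrow> complex \<Rightarrow> complex fps" where
  "cross_fps q t = (1 - fps_const t * fps_X) * (1 - fps_const (q / t) * fps_X)
     / ((1 - fps_X) * (1 - fps_const q * fps_X))"

lemma fps_divide_mult_unit: "fps_nth G 0 \<noteq> 0 \<Longrightarrow> F / G * G = (F :: complex fps)"
  by (simp add: unit_imp_dvd)

lemma cross_fps_mult:
  "cross_fps q t * ((1 - fps_X) * (1 - fps_const q * fps_X))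
     = (1 - fps_const t * fps_X) * (1 - fps_const (q / t) * fps_X)"
  unfolding cross_fps_def by (rule fps_divide_mult_unit) simp

lemma cross_fps_nth_0: "fps_nth (cross_fps q t) 0 = 1"
  using arg_cong[OF cross_fps_mult[of q t], of "\<lambda>F. fps_nth F 0"] by simp

lemma cross_fps_swap:
  assumes "q \<noteq> 0" "t \<noteq> 0"
  shows "cross_fps q (q / t) = cross_fps q t"
proof -
  have "q / (q / t) = t" using assms by simp
  then show ?thesis unfolding cross_fps_def by (simp only: mult.commute)
qed

context
  fixes q t :: complex
  assumes q: "q \<noteq> 0" "norm q < 1" and t: "t \<noteq> 0"
begin

text \<open>Case \<open>i\<close> in \<open>I\<close>, \<open>j\<close> outside: \<open>X\<close>
  becomes \<open>X / q\<close>. The numerator is \<open>t (1 - X/t)\<close>, and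
  \<open>norm_fps_contract\<close> cancels all but the constant \<open>t\<close>.\<close>

lemma contract_factor:
  "(fps_const t - fps_X) / (1 - fps_X) * (norm_fps q t oo (fps_const (inverse q) * fps_X))
     = fps_const t * norm_fps q t"
proof -
  let ?P = "(fps_const t - fps_X) / (1 - fps_X)" and ?D = "1 - fps_X :: complex fps"
  let ?G = "norm_fps q t" and ?H = "norm_fps q t oo (fps_const (inverse q) * fps_X)"
  have P: "?P * ?D = fps_const t - fps_X"
    by (rule fps_divide_mult_unit) simp
  have "fps_const t - fps_X = fps_const t * (1 - fps_const (inverse t) * fps_X)"
  proof -
    have "fps_const t * fps_const (inverse t) = 1" using t by simp
    then show ?thesis by (simp only: right_diff_distrib mult.assoc[symmetric] mult_1_left mult_1_right)
  qed
  then have P': "?P * ?D = fps_const t * (1 - fps_const (inverse t) * fps_X)"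
    unfolding P .
  have nz: "?D \<noteq> 0"
  proof
    assume "?D = 0"
    from arg_cong[OF this, of "\<lambda>F. fps_nth F 0"] show False by simp
  qed
  have "?P * ?H * ?D = (?P * ?D) * ?H" by (simp only: mult_ac)
  also have "\<dots> = fps_const t * (?H * (1 - fps_const (inverse t) * fps_X))"
    unfolding P' by (simp only: mult_ac)
  also have "\<dots> = fps_const t * ?G * ?D"
    unfolding norm_fps_contract[OF q(2,1)] by (simp only: mult.assoc)
  finally show ?thesis using nz mult_right_cancel by blast
qed

text \<open>Opposite case: \<open>X\<close> becomes \<open>q X\<close>. By
  \<open>norm_fps_dilate\<close> the factor \<open>(1 - t X)/(1 - X)\<close> is completed by
  \<open>(1 - q X/t)/(1 - q X)\<close> to \<open>cross_fps\<close>.\<close>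

lemma dilate_factor:
  "(fps_const t * fps_X - 1) / (fps_X - 1) * (norm_fps q t oo (fps_const q * fps_X))
     = cross_fps q t * norm_fps q t"
proof -
  let ?P = "(fps_const t * fps_X - 1) / (fps_X - 1)" and ?D = "1 - fps_X :: complex fps"
  let ?E = "1 - fps_const q * fps_X"
  let ?G = "norm_fps q t" and ?H = "norm_fps q t oo (fps_const q * fps_X)"
  have "?P * (fps_X - 1) = fps_const t * fps_X - 1"
    by (rule fps_divide_mult_unit) simp
  then have P: "?P * ?D = 1 - fps_const t * fps_X"
    by (metis minus_diff_eq mult_minus_right)
  have nz: "?D * ?E \<noteq> 0"
  proof
    assume "?D * ?E = 0"
    from arg_cong[OF this, of "\<lambda>F. fps_nth F 0"] show False by simp
  qed
  have "?P * ?H * (?D * ?E) = (?P * ?D) * (?H * ?E)" by (simp only: mult_ac)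
  also have "\<dots> = (1 - fps_const t * fps_X) * (?G * (1 - fps_const (q / t) * fps_X))"
    unfolding P norm_fps_dilate[OF q(2)] ..
  also have "\<dots> = (cross_fps q t * (?D * ?E)) * ?G"
    unfolding cross_fps_mult by (simp only: mult_ac)
  also have "\<dots> = cross_fps q t * ?G * (?D * ?E)" by (simp only: mult_ac)
  finally show ?thesis using nz mult_right_cancel by blast
qed

text \<open>A pair inside \<open>I\<close> or inside its complement leaves \<open>X\<close> fixed
  and carries no factor; the mixed cases are the two preceding lemmas. Writing absent factors as 1
  gives all pairs one formula.\<close>

lemma pair_conjugation:
  assumes "I \<subseteq> {1..n}" "1 \<le> i" "i < j"
  shows "(if i \<in> I \<and> j \<notin> I then RM_factor t i j else 1) * (if j \<in> I \<and> i \<notin> I then RM_factor t j i else 1)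
      * mscale (qtwist q I) (at_ratio i j (norm_fps q t))
    = (if i \<in> I \<and> j \<notin> I then mconst (cst t) else 1)
      * (if j \<in> I \<and> i \<notin> I then at_ratio i j (cross_fps q t) else 1) * at_ratio i j (norm_fps q t)"
proof -
  let ?G = "norm_fps q t"
  note at_ratio = at_ratio_mult[OF assms(3), symmetric] at_ratio_const[OF assms(3), symmetric]
  have "RM_factor t i j * at_ratio i j (?G oo (fps_const (inverse q) * fps_X)) = mconst (cst t) * at_ratio i j ?G"
    using assms(3) by (simp only: RM_factor_def if_True at_ratio contract_factor)
  moreover have "RM_factor t j i * at_ratio i j (?G oo (fps_const q * fps_X))
      = at_ratio i j (cross_fps q t) * at_ratio i j ?G"
    unfolding RM_factor_def if_not_P[OF less_not_sym[OF assms(3)]] by (simp only: at_ratio dilate_factor)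
  ultimately show ?thesis
    unfolding mscale_at_ratio[OF q(1) assms] by (auto simp: power_int_minus)
qed

end

section \<open>Conjugation of the operators by the normalizing product\<close>

definition index_pairs :: "nat \<Rightarrow> (nat \<times> nat) set" where
  "index_pairs n = {(i, j). 1 \<le> i \<and> i < j \<and> j \<le> n}"

lemma finite_index_pairs [simp]: "finite (index_pairs n)"
  by (rule finite_subset[of _ "{1..n} \<times> {1..n}"]) (auto simp: index_pairs_def)

text \<open>Each pair from \<open>I\<close> to its complement is listed under its increasing
  rearrangement, to be matched pair by pair with the factors of \<open>norm_prod\<close>.\<close>

lemma prod_complement_eq_prod_pairs:
  fixes f :: "nat \<Rightarrow> nat \<Rightarrow> 'a::comm_monoid_mult"
  assumes "I \<subseteq> {1..n}"
  shows "(\<Prod>i\<in>I. \<Prod>j\<in>{1..n} - I. f i j) = (\<Prod>(i, j)\<in>index_pairs n.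
    (if i \<in> I \<and> j \<notin> I then f i j else 1) * (if j \<in> I \<and> i \<notin> I then f j i else 1))"
proof -
  let ?U = "{(i, j) \<in> I \<times> ({1..n} - I). i < j}" and ?L = "{(i, j) \<in> I \<times> ({1..n} - I). j < i}"
  have fin: "finite (I \<times> ({1..n} - I))" using assms finite_subset by blast
  have neq: "i < j \<or> j < i" if "i \<in> I" "j \<notin> I" for i j
    using that by (metis linorder_neqE_nat)
  have "(\<Prod>i\<in>I. \<Prod>j\<in>{1..n} - I. f i j) = (\<Prod>(i, j)\<in>I \<times> ({1..n} - I). f i j)"
    by (simp add: prod.cartesian_product)
  also have "I \<times> ({1..n} - I) = ?U \<union> ?L"
    using neq by blast
  also have "(\<Prod>(i, j)\<in>?U \<union> ?L. f i j) = (\<Prod>(i, j)\<in>?U. f i j) * (\<Prod>(i, j)\<in>?L. f i j)"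
    by (rule prod.union_disjoint) (auto intro: finite_subset[OF _ fin])
  also have "(\<Prod>(i, j)\<in>?U. f i j) = (\<Prod>(i, j)\<in>index_pairs n. if i \<in> I \<and> j \<notin> I then f i j else 1)"
    by (rule prod.mono_neutral_cong_left, simp)
      (use assms in \<open>auto simp: index_pairs_def split: if_splits\<close>)
  also have "(\<Prod>(i, j)\<in>?L. f i j) = (\<Prod>(i, j)\<in>prod.swap ` ?L. f j i)"
    by (subst prod.reindex) (auto simp: case_prod_unfold)
  also have "\<dots> = (\<Prod>(i, j)\<in>index_pairs n. if j \<in> I \<and> i \<notin> I then f j i else 1)"
    by (rule prod.mono_neutral_cong_left, simp)
      (use assms in \<open>auto simp: index_pairs_def image_iff split: if_splits\<close>)
  finally show ?thesis by (simp add: prod.distrib case_prod_unfold)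
qed

section \<open>Cancellation of the powers of \<open>t\<close>\<close>

lemma card_increasing_pairs:
  fixes I :: "'a::linorder set"
  assumes "finite I"
  shows "card {(i, j). i \<in> I \<and> j \<in> I \<and> i < j} = card I choose 2"
  using assms
proof (induction I rule: finite_linorder_max_induct)
  case (insert b A)
  have b: "b \<notin> A" using insert.hyps by auto
  \<comment> \<open>As \<open>b\<close> exceeds every element of \<open>A\<close>, the new pairs are
    exactly those ending in \<open>b\<close>.\<close>
  have "{(i, j). i \<in> insert b A \<and> j \<in> insert b A \<and> i < j}
      = {(i, j). i \<in> A \<and> j \<in> A \<and> i < j} \<union> (\<lambda>a. (a, b)) ` A"
    using insert.hyps(2) by auto
  moreover have "finite {(i, j). i \<in> A \<and> j \<in> A \<and> i < j}"
    by (rule finite_subset[of _ "A \<times> A"]) (use insert.hyps(1) in auto)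
  moreover have "card ((\<lambda>a. (a, b)) ` A) = card A"
    by (rule card_image) (auto simp: inj_on_def)
  moreover have "{(i, j). i \<in> A \<and> j \<in> A \<and> i < j} \<inter> (\<lambda>a. (a, b)) ` A = {}"
    using b by auto
  ultimately have "card {(i, j). i \<in> insert b A \<and> j \<in> insert b A \<and> i < j} = (card A choose 2) + card A"
    using insert.IH insert.hyps by (simp only: card_Un_disjoint finite_imageI)
  then show ?case using insert.hyps(1) b by (simp add: numeral_2_eq_2)
qed simp

text \<open>Count the pairs with \<open>i\<close> in \<open>I\<close> and \<open>i < j <= n\<close>,
  separating \<open>j\<close> in \<open>I\<close> from \<open>j\<close> outside.\<close>

lemma card_pairs_leaving:
  assumes "I \<subseteq> {1..n}"
  shows "(card I choose 2) + card {(i, j)\<in>index_pairs n. i \<in> I \<and> j \<notin> I} = (\<Sum>i\<in>I. n - i)"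
proof -
  have fin: "finite I" using assms finite_subset by blast
  have "(\<Sum>i\<in>I. n - i) = card (SIGMA i:I. {i<..n})"
    using fin by simp
  also have "(SIGMA i:I. {i<..n}) = {(i, j). i \<in> I \<and> j \<in> I \<and> i < j} \<union> {(i, j)\<in>index_pairs n. i \<in> I \<and> j \<notin> I}"
    using assms by (auto simp: index_pairs_def)
  also have "card \<dots> = card {(i, j). i \<in> I \<and> j \<in> I \<and> i < j} + card {(i, j)\<in>index_pairs n. i \<in> I \<and> j \<notin> I}"
    by (rule card_Un_disjoint) (auto intro: finite_subset[of _ "I \<times> I"] finite_subset[OF _ finite_index_pairs] fin)
  finally show ?thesis by (simp add: card_increasing_pairs[OF fin])
qed

text \<open>The three factors come from the prefactor of \<open>D_r\<close>, from the constants left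
  by conjugation, and from the shifts acting on \<open>x^\<lambda>\<close>.\<close>

lemma t_power_balance:
  fixes t :: complex
  assumes "t \<noteq> 0" "I \<subseteq> {1..n}"
  shows "t ^ (card I choose 2) * (\<Prod>(i, j)\<in>index_pairs n. if i \<in> I \<and> j \<notin> I then t else 1)
    * (\<Prod>i\<in>I. t powi (int i - int n)) = 1"
proof -
  let ?K = "{p\<in>index_pairs n. fst p \<in> I \<and> snd p \<notin> I}"
  have pairs: "(\<Prod>(i, j)\<in>index_pairs n. if i \<in> I \<and> j \<notin> I then t else 1) = t ^ card ?K"
    unfolding prod_constant[symmetric] by (simp add: case_prod_unfold prod.inter_filter del: prod_constant)
  have "(\<Prod>i\<in>I. t powi (int i - int n)) = t powi - int (\<Sum>i\<in>I. n - i)"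
    unfolding power_int_sum[OF assms(1), symmetric] of_nat_sum sum_negf[symmetric]
    using assms(2) by (intro arg_cong[where f = "(powi) t"] sum.cong) auto
  moreover have "(\<Sum>i\<in>I. n - i) = (card I choose 2) + card ?K"
    using card_pairs_leaving[OF assms(2)] by (simp add: case_prod_unfold)
  ultimately have "(\<Prod>i\<in>I. t powi (int i - int n)) = inverse (t ^ ((card I choose 2) + card ?K))"
    by (simp only: power_int_minus power_int_of_nat)
  moreover have "t ^ ((card I choose 2) + card ?K) \<noteq> 0"
    using assms(1) by simp
  ultimately show ?thesis
    unfolding pairs power_add[symmetric] by (simp only: right_inverse not_False_eq_True)
qed

text \<open>
  \<open>psi_op n q t I\<close> is the summand of \<open>I\<close> in the equation for \<open>\<psi>\<close>, without the factor \<open>(-u)\<^sup>|\<^sup>I\<^sup>|\<close>.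
\<close>

definition psi_coeff :: "nat \<Rightarrow> complex \<Rightarrow> complex \<Rightarrow> nat set \<Rightarrow> ratfun mfps" where
  "psi_coeff n q t I = (\<Prod>(i, j)\<in>index_pairs n. if j \<in> I \<and> i \<notin> I then at_ratio i j (cross_fps q t) else 1)"

definition psi_op :: "nat \<Rightarrow> complex \<Rightarrow> complex \<Rightarrow> nat set \<Rightarrow> ratfun mfps \<Rightarrow> ratfun mfps" where
  "psi_op n q t I F = psi_coeff n q t I * (mconst (\<Prod>i\<in>I. svar i) * mscale (qtwist q I) F)"

lemma q_shift_eq:
  "q_shift n q t I F = mconst (cst (\<Prod>i\<in>I. t powi (int i - int n)))
     * (mconst (\<Prod>i\<in>I. svar i) * mscale (qtwist q I) F)"
  by (rule mfps_eqI)
    (unfold mcoeff_mconst_mult mcoeff_mscale q_shift_def mcoeff_Mfps qtwist_def cst_prod prod.distrib, simp only: mult_ac)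

text \<open>Shifts respect products, so the identities for single pairs multiply up to one for
  \<open>norm_prod\<close>; the scalars in \<open>t\<close> cancel by
  \<open>t_power_balance\<close>.\<close>

lemma norm_prod_conjugation:
  assumes q: "q \<noteq> 0" "norm q < 1" and t: "t \<noteq> 0" and I: "I \<subseteq> {1..n}"
  shows "mconst (cst (t ^ (card I choose 2))) * ((\<Prod>i\<in>I. \<Prod>j\<in>{1..n} - I. RM_factor t i j)
      * q_shift n q t I (norm_prod n q t * F)) = norm_prod n q t * psi_op n q t I F"
proof -
  let ?h = "mscale (qtwist q I)"
  let ?N = "norm_prod n q t"
  let ?R = "\<lambda>i j. (if i \<in> I \<and> j \<notin> I then RM_factor t i j else 1) * (if j \<in> I \<and> i \<notin> I then RM_factor t j i else 1)"
  let ?t = "\<Prod>(i, j)\<in>index_pairs n. if i \<in> I \<and> j \<notin> I then t else 1"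
  let ?c = "\<Prod>i\<in>I. t powi (int i - int n)"
  let ?S = "mconst (\<Prod>i\<in>I. svar i) * ?h F"
  have N: "?N = (\<Prod>(i, j)\<in>index_pairs n. at_ratio i j (norm_fps q t))"
    by (simp add: norm_prod_def index_pairs_def)
  have hN: "?h ?N = (\<Prod>(i, j)\<in>index_pairs n. ?h (at_ratio i j (norm_fps q t)))"
    unfolding N by (subst mscale_prod) (simp_all add: qtwist_0 qtwist_add q case_prod_unfold)
  have "(\<Prod>i\<in>I. \<Prod>j\<in>{1..n} - I. RM_factor t i j) * ?h ?N
      = (\<Prod>(i, j)\<in>index_pairs n. ?R i j * ?h (at_ratio i j (norm_fps q t)))"
    unfolding prod_complement_eq_prod_pairs[OF I] hN by (simp add: prod.distrib case_prod_unfold)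
  also have "\<dots> = (\<Prod>(i, j)\<in>index_pairs n. (if i \<in> I \<and> j \<notin> I then mconst (cst t) else 1)
      * (if j \<in> I \<and> i \<notin> I then at_ratio i j (cross_fps q t) else 1) * at_ratio i j (norm_fps q t))"
    by (rule prod.cong[OF refl]) (auto simp only: index_pairs_def mem_Collect_eq case_prod_conv
        pair_conjugation[OF q t I])
  also have "\<dots> = (\<Prod>(i, j)\<in>index_pairs n. if i \<in> I \<and> j \<notin> I then mconst (cst t) else 1)
      * psi_coeff n q t I * ?N"
    unfolding N psi_coeff_def by (simp add: prod.distrib case_prod_unfold)
  also have "(\<Prod>(i, j)\<in>index_pairs n. if i \<in> I \<and> j \<notin> I then mconst (cst t) else 1) = mconst (cst ?t)"
    unfolding cst_prod mconst_prod by (intro prod.cong) auto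
  finally have RN: "(\<Prod>i\<in>I. \<Prod>j\<in>{1..n} - I. RM_factor t i j) * ?h ?N
      = mconst (cst ?t) * psi_coeff n q t I * ?N" .
  have "mconst (cst (t ^ (card I choose 2))) * ((\<Prod>i\<in>I. \<Prod>j\<in>{1..n} - I. RM_factor t i j)
      * q_shift n q t I (?N * F))
    = mconst (cst (t ^ (card I choose 2))) * mconst (cst ?c)
      * ((\<Prod>i\<in>I. \<Prod>j\<in>{1..n} - I. RM_factor t i j) * ?h ?N) * ?S"
    unfolding q_shift_eq by (subst mscale_mult) (simp_all only: qtwist_0 qtwist_add[OF q(1)] mult_ac)
  also have "\<dots> = mconst (cst (t ^ (card I choose 2) * ?t * ?c)) * (psi_coeff n q t I * ?N * ?S)"
    unfolding RN cst_mult mconst_mult by (simp only: mult_ac)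
  also have "\<dots> = ?N * psi_op n q t I F"
    unfolding t_power_balance[OF t I] by (simp add: psi_op_def mult_ac)
  finally show ?thesis .
qed

section \<open>Uniqueness of the series\<close>

text \<open>Evaluation at \<open>u = c\<close> is a coefficientwise ring homomorphism that undoes
  \<open>ulift\<close>. The sums over \<open>r\<close> and over subsets of size \<open>r\<close>
  merge into one.\<close>

lemma RM_eigenseries_eval:
  assumes "RM_eigenseries n q t \<phi>"
  shows "(\<Sum>I\<in>Pow {1..n}. mconst ((- c) ^ card I) * (mconst (cst (t ^ (card I choose 2)))
      * ((\<Prod>i\<in>I. \<Prod>j\<in>{1..n} - I. RM_factor t i j) * q_shift n q t I \<phi>)))
    = \<phi> * mconst (\<Prod>i=1..n. 1 - c * svar i)"
    (is "(\<Sum>I\<in>_. ?f I) = _")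
proof -
  let ?ev = "map_mfps (\<lambda>p. poly p c)"
  have ev_lift: "?ev (ulift F) = F" for F
    by (rule mfps_eqI) (simp add: map_mfps_def)
  have ev_const: "?ev (mconst p) = mconst (poly p c)" for p
    by (rule map_mfps_mconst) simp_all
  have ev_mult: "?ev (F * G) = ?ev F * ?ev G" for F G
    by (rule map_mfps_mult) simp_all
  have "?ev (RM_gen n q t \<phi>) = (\<Sum>r\<le>n. mconst ((- c) ^ r) * RM_op n q t r \<phi>)"
    unfolding RM_gen_def
    by (subst map_mfps_sum)
      (simp_all add: ev_mult map_mfps_power ev_const ev_lift mconst_power flip: mconst_uminus)
  also have "\<dots> = (\<Sum>r\<le>n. \<Sum>I | I \<in> Pow {1..n} \<and> card I = r. ?f I)"
    unfolding RM_op_def sum_distrib_left by (intro sum.cong) auto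
  also have "\<dots> = (\<Sum>I\<in>Pow {1..n}. ?f I)"
    by (rule sum.group) (auto dest: card_mono[rotated])
  finally have L: "?ev (RM_gen n q t \<phi>) = (\<Sum>I\<in>Pow {1..n}. ?f I)" .
  have one: "(1 :: ratfun poly mfps) = mconst 1" by simp
  have "?ev (ulift \<phi> * (\<Prod>i=1..n. 1 - uvar * mconst [:svar i:])) = \<phi> * mconst (\<Prod>i=1..n. 1 - c * svar i)"
    unfolding ev_mult ev_lift one mconst_mult[symmetric] mconst_diff[symmetric] mconst_prod[symmetric] ev_const
    by (simp add: poly_prod)
  with L assms show ?thesis by (simp add: RM_eigenseries_def)
qed

text \<open>The weights are successive differences of the exponents; if all vanish, induction from
  \<open>m_0 = 0\<close> gives \<open>m = 0\<close>.\<close>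

lemma exists_wt_nonzero:
  assumes "m \<in> Qplus n" "m \<noteq> 0"
  obtains k where "k \<in> {1..n}" "wt m k \<noteq> 0"
proof (rule ccontr)
  assume "\<not> thesis"
  with that have w: "wt m k = 0" if "k \<in> {1..n}" for k using that by blast
  have 0: "Poly_Mapping.lookup m k = 0" if "k \<notin> {1..<n}" for k
    using assms(1) that by (auto simp: Qplus_def in_keys_iff)
  have "Poly_Mapping.lookup m k = 0" for k
  proof (induction k)
    case (Suc k)
    show ?case using w[of "Suc k"] 0[of "Suc k"] Suc by (cases "Suc k \<in> {1..n}") (auto simp: wt_def)
  qed (simp add: 0)
  then have "m = 0" by (intro poly_mapping_eqI) simp
  with assms(2) show False by simp
qed

text \<open>Here \<open>u\<close> runs over values \<open>c\<close> among the rational functions in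
  \<open>s\<close>, because uniqueness inserts \<open>u = 1/s_k\<close>.\<close>

definition psi_equation :: "nat \<Rightarrow> complex \<Rightarrow> complex \<Rightarrow> ratfun mfps \<Rightarrow> bool" where
  "psi_equation n q t F \<longleftrightarrow> (\<forall>c. (\<Sum>I\<in>Pow {1..n}. mconst ((- c) ^ card I) * psi_op n q t I F)
     = F * mconst (\<Prod>i=1..n. 1 - c * svar i))"

text \<open>The equation is triangular: at \<open>m\<close> the coefficient of \<open>F\<close>
  there appears with a scalar factor, and all other coefficients of \<open>F\<close> belong to
  proper splittings, where \<open>F\<close> and \<open>G\<close> agree by induction.\<close>

lemma psi_equation_unique:
  assumes q: "q \<noteq> 0" "norm q < 1"
    and F: "psi_equation n q t F" and G: "psi_equation n q t G"
    and "F \<in> xseries n" "G \<in> xseries n" "mcoeff F 0 = mcoeff G 0"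
  shows "F = G"
proof (rule mfps_eqI)
  fix m show "mcoeff F m = mcoeff G m"
  proof (induction m rule: proper_splits_induct)
    case (1 m)
    consider "m = 0" | "m \<notin> Qplus n" | k where "k \<in> {1..n}" "wt m k \<noteq> 0"
      using exists_wt_nonzero by blast
    then show ?case
    proof cases
      case (3 k)
      \<comment> \<open>At \<open>u = 1/s\<^sub>k\<close> the eigenvalue vanishes, but the coefficient of \<open>\<psi>\<^sub>\<mu>\<close> on the left does not,
        since \<open>s\<^sub>i q\<^sup>-\<^sup>\<mu>\<^sup>i = s\<^sub>k\<close> would force \<open>i = k\<close> and \<open>\<mu>\<^sub>k = 0\<close>.\<close>
      define c where "c = inverse (svar k)"
      let ?s = "\<lambda>I. \<Prod>i\<in>I. svar i"
      let ?low = "\<lambda>H I. \<Sum>(a, b)\<in>proper_splits m. mcoeff (psi_coeff n q t I) a * (?s I * (qtwist q I b * mcoeff H b))"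
      let ?E = "\<Sum>I\<in>Pow {1..n}. (- c) ^ card I * (?s I * qtwist q I m)"
      \<comment> \<open>Each \<open>cross_fps\<close> has constant term 1, so the diagonal part of
        \<open>psi_op\<close> is the scalar of the shift alone.\<close>
      have c0: "mcoeff (psi_coeff n q t I) 0 = 1" for I
        unfolding psi_coeff_def mcoeff_prod_0
        by (rule prod.neutral) (auto simp: index_pairs_def cross_fps_nth_0 mcoeff_one)
      have "(\<Prod>i=1..n. 1 - c * svar i) = 0"
        using 3(1) by (auto simp: c_def intro!: bexI[of _ k])
      then have zero: "(\<Sum>I\<in>Pow {1..n}. (- c) ^ card I * mcoeff (psi_op n q t I H) m) = 0"
        if "psi_equation n q t H" for H
        using arg_cong[OF that[unfolded psi_equation_def, THEN spec[of _ c]], of "\<lambda>F. mcoeff F m"]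
        by (simp add: mcoeff_sum mult.commute[of H])
      have split: "mcoeff (psi_op n q t I H) m = ?s I * qtwist q I m * mcoeff H m + ?low H I" for I H
        by (simp add: psi_op_def mcoeff_mult_split[of "psi_coeff n q t I"] c0 mult.assoc)
      have low: "?low F I = ?low G I" for I
        using 1 by (intro sum.cong) auto
      have "?E * (mcoeff F m - mcoeff G m)
          = (\<Sum>I\<in>Pow {1..n}. (- c) ^ card I * mcoeff (psi_op n q t I F) m)
            - (\<Sum>I\<in>Pow {1..n}. (- c) ^ card I * mcoeff (psi_op n q t I G) m)"
        unfolding split low sum_distrib_right sum_subtractf[symmetric]
        by (intro sum.cong) (simp_all add: algebra_simps)
      also have "\<dots> = 0"
        using zero[OF F] zero[OF G] by simp
      finally have "?E * (mcoeff F m - mcoeff G m) = 0" .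
      moreover have "?E \<noteq> 0"
      proof -
        let ?x = "\<lambda>i. c * (svar i * cst (q powi (- wt m i)))"
        \<comment> \<open>Read backwards, the sum over subsets is an expanded product, so it is
          nonzero if each factor is.\<close>
        have "?E = (\<Prod>i=1..n. 1 - ?x i)"
          unfolding prod_diff_conv_sum[OF finite_atLeastAtMost]
          by (intro sum.cong) (auto simp: qtwist_def prod.distrib power_minus[of c])
        moreover have "1 - ?x i \<noteq> 0" if "i \<in> {1..n}" for i
        proof
          assume "1 - ?x i = 0"
          then have "svar i * cst (q powi (- wt m i)) = svar k"
            by (simp add: c_def field_simps)
          then have "i = k" "q powi (- wt m i) = 1"
            using cst_svar_eqD by blast+
          then have "q powi wt m k = 1"
            by (simp add: power_int_minus)
          \<comment> \<open>With the sign of the exponent removed, a nonzero exponent would force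
            \<open>norm q = 1\<close>.\<close>
          then have "q ^ nat \<bar>wt m k\<bar> = 1"
            by (auto simp: power_int_def abs_if power_inverse split: if_splits)
          then have "norm q = 1 \<or> nat \<bar>wt m k\<bar> = 0"
            by (rule power_eq_1_iff)
          with q 3(2) show False by simp
        qed
        ultimately show ?thesis by simp
      qed
      ultimately show ?thesis by simp
    qed (use assms in \<open>auto simp: xseries_def\<close>)
  qed
qed

theorem theorem1p2:
  fixes n :: nat and q t :: complex and \<phi> \<phi>' \<psi> \<psi>' :: "ratfun mfps"
  assumes "n \<ge> 1" and "q \<noteq> 0" and "norm q < 1" and "t \<noteq> 0"
    and "RM_eigenseries n q t \<phi>" and "\<phi> = norm_prod n q t * \<psi>"
    and "RM_eigenseries n q (q / t) \<phi>'" and "\<phi>' = norm_prod n q (q / t) * \<psi>'"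
  shows "\<psi> \<in> xseries n \<and> \<psi> = \<psi>'"
proof -
  \<comment> \<open>Stated for any nonzero parameter, to be applied to both \<open>t\<close> and
    \<open>q / t\<close>.\<close>
  have *: "\<psi> \<in> xseries n \<and> mcoeff \<psi> 0 = 1 \<and> psi_equation n q t \<psi>"
    if t: "t \<noteq> 0" and eig: "RM_eigenseries n q t \<phi>" and \<phi>: "\<phi> = norm_prod n q t * \<psi>" for t \<phi> \<psi>
  proof -
    let ?N = "norm_prod n q t"
    have N_0: "mcoeff ?N 0 = 1"
      unfolding norm_prod_def mcoeff_prod_0
      by (rule prod.neutral) (auto simp: norm_fps_nth_0[OF assms(3)])
    have N: "?N \<in> xseries n"
      unfolding norm_prod_def by (rule xseries_prod) (auto intro: at_ratio_xseries)
    have "\<psi> \<in> xseries n"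
      using xseries_mult_cancel[OF N N_0] eig \<phi> by (simp add: RM_eigenseries_def)
    moreover have "mcoeff \<psi> 0 = 1"
      using eig N_0 \<phi> by (simp add: RM_eigenseries_def)
    moreover have "psi_equation n q t \<psi>"
      unfolding psi_equation_def
    \<comment> \<open>Multiplied by the normalizing product, which has constant term 1, the claim
      becomes the eigenvalue equation of \<open>\<phi>\<close>.\<close>
    proof (rule allI, rule mfps_mult_left_cancel[OF N_0])
      fix c
      have "?N * (\<Sum>I\<in>Pow {1..n}. mconst ((- c) ^ card I) * psi_op n q t I \<psi>)
          = (\<Sum>I\<in>Pow {1..n}. mconst ((- c) ^ card I) * (?N * psi_op n q t I \<psi>))"
        by (simp add: sum_distrib_left mult.left_commute)
      also have "\<dots> = (\<Sum>I\<in>Pow {1..n}. mconst ((- c) ^ card I) * (mconst (cst (t ^ (card I choose 2)))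
          * ((\<Prod>i\<in>I. \<Prod>j\<in>{1..n} - I. RM_factor t i j) * q_shift n q t I (?N * \<psi>))))"
        by (intro sum.cong refl) (simp only: Pow_iff norm_prod_conjugation[OF assms(2,3) t])
      also have "\<dots> = ?N * \<psi> * mconst (\<Prod>i=1..n. 1 - c * svar i)"
        using RM_eigenseries_eval[OF eig, of c] by (simp only: \<phi>)
      finally show "?N * (\<Sum>I\<in>Pow {1..n}. mconst ((- c) ^ card I) * psi_op n q t I \<psi>)
          = ?N * (\<psi> * mconst (\<Prod>i=1..n. 1 - c * svar i))"
        by (simp only: mult.assoc)
    qed
    ultimately show ?thesis by blast
  qed
  \<comment> \<open>The parameter \<open>t\<close> occurs in the equation only inside
    \<open>cross_fps\<close>, which is symmetric.\<close>
  have "psi_equation n q (q / t) = psi_equation n q t"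
    by (intro ext) (unfold psi_equation_def psi_op_def psi_coeff_def cross_fps_swap[OF assms(2,4)], rule refl)
  then have \<psi>': "\<psi>' \<in> xseries n \<and> mcoeff \<psi>' 0 = 1 \<and> psi_equation n q t \<psi>'"
    using *[OF _ assms(7,8)] assms by simp
  have \<psi>: "\<psi> \<in> xseries n \<and> mcoeff \<psi> 0 = 1 \<and> psi_equation n q t \<psi>"
    by (rule *[OF assms(4-6)])
  have "\<psi> = \<psi>'"
    by (rule psi_equation_unique[OF assms(2,3)]) (use \<psi> \<psi>' in auto)
  with \<psi> show ?thesis by blast
qed

end
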